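(* Let $m$ be a positive integer. Then there exists a highly composite number $N$ such that $m!\mid N$.
   Context: A positive integer $N$ is highly composite if $d(k)<d(N)$ for every positive integer $k<N$, where $d$ is the number-of-divisors function. *)

theory Defs
  imports "HOL-Computational_Algebra.Primes"
begin

definition divisor_count :: "nat \<Rightarrow> nat" where
  "divisor_count n = card {k. k dvd n}"

definition highly_composite :: "nat \<Rightarrow> bool" where
  "highly_composite N \<longleftrightarrow> N > 0 \<and> (\<forall>k. 0 < k \<and> k < N \<longrightarrow> divisor_count k < divisor_count N)"

end

theory Submission
  imports Defs
begin

text \<open>
  If \<open>q\<close> divides a highly composite \<open>N\<close> exactly \<open>a\<close> times and another prime \<open>p\<close> divides it exactly
  \<open>e\<close> times, multiplying \<open>N\<close> by \<open>q ^ (a + 1)\<close> doubles the divisor count, while dividing it by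
  \<open>p ^ \<lceil>e/2\<rceil>\<close> at most halves it. Hence \<open>p ^ \<lceil>e/2\<rceil> \<le> q ^ (a + 1)\<close>, so every prime power dividing
  \<open>N\<close> is at most \<open>B = q ^ (2 * (a + 1))\<close> and \<open>N\<close> divides \<open>B!\<close>. If \<open>F\<close> does not divide \<open>N\<close>, then
  \<open>q ^ (a + 1)\<close> divides \<open>F\<close> for some \<open>q\<close>, so \<open>N \<le> (F\<^sup>2)!\<close>. But there are arbitrarily large highly
  composite numbers.
\<close>

text \<open>Each divisor is \<open>p ^ i * k\<close> for exactly one \<open>i \<le> e\<close> and
  one divisor \<open>k\<close> of \<open>M\<close>: as \<open>p\<close> does not divide
  \<open>k\<close>, the exponent \<open>i\<close> is recovered as a multiplicity.\<close>

lemma divisor_count_prime_power_mult: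
  assumes p: "prime p" and M: "\<not> p dvd M"
  shows "divisor_count (p ^ e * M) = (e + 1) * divisor_count M"
proof -
  let ?f = "\<lambda>(i, k). p ^ i * k"
  have "inj_on ?f ({..e} \<times> {k. k dvd M})"
  proof (rule inj_onI, clarsimp)
    fix i j k l
    assume kl: "k dvd M" "l dvd M" and eq: "p ^ i * k = p ^ j * l"
    have ndvd: "\<not> p dvd k" "\<not> p dvd l" using kl M dvd_trans by blast+
    have "multiplicity p (p ^ i * k) = i" "multiplicity p (p ^ j * l) = j"
      using ndvd p by (simp_all add: multiplicity_eqI)
    with eq have "i = j" by simp
    with eq p show "i = j \<and> k = l" by auto
  qed
  moreover have "?f ` ({..e} \<times> {k. k dvd M}) = {k. k dvd p ^ e * M}"
  proof
    show "?f ` ({..e} \<times> {k. k dvd M}) \<subseteq> {k. k dvd p ^ e * M}"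
      by (auto intro: mult_dvd_mono le_imp_power_dvd)
    show "{k. k dvd p ^ e * M} \<subseteq> ?f ` ({..e} \<times> {k. k dvd M})"
    proof
      fix k assume "k \<in> {k. k dvd p ^ e * M}"
      then obtain b c where "k = b * c" "b dvd p ^ e" "c dvd M"
        using division_decomp by blast
      moreover from this obtain i where "i \<le> e" "b = p ^ i"
        using divides_primepow_nat p by blast
      ultimately show "k \<in> ?f ` ({..e} \<times> {k. k dvd M})" by force
    qed
  qed
  ultimately have "card {k. k dvd p ^ e * M} = card ({..e} \<times> {k. k dvd M})"
    by (metis card_image)
  then show ?thesis by (simp add: divisor_count_def card_cartesian_product)
qed

lemma divisor_count_le: "n > 0 \<Longrightarrow> divisor_count n \<le> n"
  unfolding divisor_count_def
  using card_mono[of "{1..n}" "{k. k dvd n}"] by (force dest: dvd_imp_le intro: Nat.gr0I)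

text \<open>The least number with more than \<open>C\<close> divisors works: smaller positive
  numbers have at most \<open>C\<close>, and \<open>divisor_count N \<le> N\<close> gives
  \<open>C < N\<close>.\<close>

lemma ex_highly_composite_gt: "\<exists>N. highly_composite N \<and> C < N"
proof -
  define P where "P N \<longleftrightarrow> 0 < N \<and> C < divisor_count N" for N
  have "divisor_count (2 ^ C * 1) = C + 1"
    using divisor_count_prime_power_mult[of 2 1 C] by (simp add: divisor_count_def)
  then have "P (2 ^ C)" by (simp add: P_def)
  define N where "N = (LEAST N. P N)"
  have N: "P N" unfolding N_def by (rule LeastI) fact
  have "highly_composite N"
    unfolding highly_composite_def
  proof (intro conjI allI impI)
    show "0 < N" using N by (simp add: P_def)
    fix k assume k: "0 < k \<and> k < N"
    then have "\<not> P k" unfolding N_def using not_less_Least by blast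
    then show "divisor_count k < divisor_count N" using k N by (auto simp: P_def)
  qed
  moreover have "C < N"
    using N divisor_count_le[of N] by (auto simp: P_def)
  ultimately show ?thesis by blast
qed

lemma highly_composite_prime_power_le:
  assumes N: "highly_composite N" and p: "prime p" and q: "prime q" and "p \<noteq> q"
  shows "p ^ multiplicity p N \<le> (q ^ (multiplicity q N + 1))\<^sup>2"
proof (rule ccontr)
  define a e where "a = multiplicity q N" and "e = multiplicity p N"
  \<comment> \<open>Half of \<open>e\<close>, rounded up: \<open>e \<le> 2 * i\<close> passes the
    strict bound on to \<open>p ^ i\<close>, and \<open>2 * i \<le> e + 1\<close> keeps at least
    half of the factor \<open>e + 1\<close> in the divisor count.\<close>
  define i where "i = (e + 1) div 2"
  assume "\<not> ?thesis"
  then have big: "(q ^ (a + 1))\<^sup>2 < p ^ e" by (simp add: a_def e_def)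
  have "p ^ e \<le> (p ^ i)\<^sup>2"
    using prime_gt_0_nat[OF p] by (simp add: i_def flip: power_mult) (rule power_increasing; simp)
  with big have Qp: "q ^ (a + 1) < p ^ i"
    by (meson less_le_trans power_less_imp_less_base zero_le)
  have N0: "N > 0" using N by (simp add: highly_composite_def)
  obtain R where R: "N = p ^ e * R" "\<not> p dvd R"
    using multiplicity_decompose'[of N p] N0 p unfolding e_def by (metis not_prime_unit less_irrefl)
  \<comment> \<open>Splitting off the \<open>p\<close>-part does not change the exponent of
    \<open>q\<close>, so \<open>N = p ^ e * q ^ a * M\<close>.\<close>
  have "multiplicity q N = multiplicity q R"
    using R N0 p q \<open>p \<noteq> q\<close>
    by (simp add: prime_elem_multiplicity_mult_distrib prime_elem_multiplicity_power_distrib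
        prime_multiplicity_other)
  then obtain M where M: "R = q ^ a * M" "\<not> q dvd M"
    using multiplicity_decompose'[of R q] R N0 q unfolding a_def
    by (metis not_prime_unit less_irrefl mult_0_right)
  have pq: "\<not> p dvd q ^ b" for b
    using p q \<open>p \<noteq> q\<close> by (metis prime_dvd_power primes_dvd_imp_eq)
  have pM: "\<not> p dvd q ^ b * M" for b
    using R(2) M(1) pq p by (auto simp: prime_dvd_mult_iff)
  \<comment> \<open>This is \<open>N * q ^ (a + 1) / p ^ i\<close>, factored so that the counting
    lemma applies twice. The new exponent \<open>2 * a + 1\<close> of \<open>q\<close> turns the
    factor \<open>a + 1\<close> into \<open>2 * (a + 1)\<close>.\<close>
  define N' where "N' = p ^ (e - i) * (q ^ (a + (a + 1)) * M)"
  have ie: "i \<le> e" unfolding i_def using big by (cases e) auto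
  have "N' * p ^ i = p ^ (e - i + i) * (q ^ (a + (a + 1)) * M)"
    unfolding N'_def power_add by (simp add: algebra_simps)
  also have "\<dots> = N * q ^ (a + 1)"
    using ie R(1) M(1) by (simp add: power_add algebra_simps)
  also have "\<dots> < N * p ^ i" using Qp N0 by simp
  finally have "N' < N" by simp
  moreover have "N' > 0"
    unfolding N'_def using N0 R M p q by (auto simp: prime_gt_0_nat)
  ultimately have "divisor_count N' < divisor_count N"
    using N by (simp add: highly_composite_def)
  moreover have "divisor_count N = (e + 1) * ((a + 1) * divisor_count M)"
    unfolding R(1) M(1) using divisor_count_prime_power_mult p q pM M(2) by simp
  moreover have "divisor_count N' = (e - i + 1) * ((2 * (a + 1)) * divisor_count M)"
    unfolding N'_def
    unfolding divisor_count_prime_power_mult[OF p pM] divisor_count_prime_power_mult[OF q M(2)]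
    by (simp add: mult_2)
  moreover have "\<dots> = (2 * (e - i + 1)) * ((a + 1) * divisor_count M)"
    by simp
  moreover have "e + 1 \<le> 2 * (e - i + 1)" unfolding i_def by presburger
  ultimately show False
    by (metis mult_le_mono1 not_le)
qed

lemma highly_composite_dvd_fact:
  assumes N: "highly_composite N" and q: "prime q"
  shows "N dvd fact ((q ^ (multiplicity q N + 1))\<^sup>2)"
proof (rule multiplicity_le_imp_dvd)
  let ?B = "(q ^ (multiplicity q N + 1))\<^sup>2"
  show "N \<noteq> 0" using N by (simp add: highly_composite_def)
  fix p :: nat assume p: "prime p"
  have "p ^ multiplicity p N \<le> ?B"
  proof (cases "p = q")
    \<comment> \<open>Here only exponents are compared: \<open>a \<le> 2 * (a + 1)\<close> for
      \<open>a = multiplicity q N\<close>.\<close>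
    case True
    then show ?thesis
      using prime_gt_0_nat[OF q] by (simp flip: power_mult power_Suc) (rule power_increasing; simp)
  qed (use highly_composite_prime_power_le[OF N p q] in simp)
  then have "p ^ multiplicity p N dvd fact ?B"
    using p by (intro dvd_fact) (auto simp: prime_gt_0_nat Suc_le_eq)
  then show "multiplicity p N \<le> multiplicity p (fact ?B)"
    using p by (intro multiplicity_geI) auto
qed

lemma dvd_highly_composite:
  assumes N: "highly_composite N" and "F > 0" and large: "fact (F\<^sup>2) < N"
  shows "F dvd N"
proof (rule ccontr)
  assume "\<not> F dvd N"
  then obtain q where q: "prime q" "multiplicity q N < multiplicity q F"
    using multiplicity_le_imp_dvd[of F N] \<open>F > 0\<close> by (metis not_le less_irrefl)
  then have "q ^ (multiplicity q N + 1) dvd F"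
    by (intro multiplicity_dvd') simp
  \<comment> \<open>The bound now depends on \<open>F\<close> alone, so one threshold for
    \<open>N\<close> serves every \<open>q\<close>.\<close>
  then have "(q ^ (multiplicity q N + 1))\<^sup>2 \<le> F\<^sup>2"
    using \<open>F > 0\<close> by (intro power_mono dvd_imp_le) auto
  then have "fact ((q ^ (multiplicity q N + 1))\<^sup>2) \<le> (fact (F\<^sup>2) :: nat)"
    by (rule fact_mono)
  moreover have "N \<le> fact ((q ^ (multiplicity q N + 1))\<^sup>2)"
    using highly_composite_dvd_fact[OF N q(1)] by (rule dvd_imp_le) simp
  ultimately show False using large by linarith
qed

theorem proposition57:
  fixes m :: nat
  assumes "m > 0"
  shows "\<exists>N. highly_composite N \<and> fact m dvd N"
  using ex_highly_composite_gt dvd_highly_composite[of _ "fact m"] by (metis fact_gt_zero)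

end
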